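(* Let $X(U)$ and $Y(U)$, $U\in\{2,3,\dots\}$, be positive integers, all at least $2$, such that $$\liminf_{U\to\infty}\frac{\log X(U)}{\log U} > 1 \qquad\text{and}\qquad \liminf_{U\to\infty}\frac{\log Y(U)}{\log U} > 3 .$$ For each $U$, let $\bm{A}_I$ be the identity target function on $\{0,\dots,U-1\}^2$, i.e. $a(u_1,u_2)=(u_1,u_2)$, and let $\mathcal{G}(X,Y)$ denote the set of all functions $g\colon\{0,\dots,X-1\}\times\{0,\dots,X-1\}\to\{0,\dots,Y-1\}$. Then $$\lim_{U\to\infty}\frac{\bigl|\{\bm{G}\in\mathcal{G}(X(U),Y(U)) : (\bm{A}_I,\bm{G})\text{ is }0\text{-feasible}\}\bigr|}{|\mathcal{G}(X(U),Y(U))|}=1 .$$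
   Context: A target function is a map $a\colon\mathcal{U}\times\mathcal{U}\to\mathcal{W}$ with $\mathcal{U}=\{0,\dots,U-1\}$ and $\mathcal{W}$ a finite set, identified with its $U\times U$ matrix $\bm{A}$. A (deterministic two-user multiple-access) channel is a map $g\colon\mathcal{X}\times\mathcal{X}\to\mathcal{Y}$ with $\mathcal{X}=\{0,\dots,X-1\}$, $\mathcal{Y}=\{0,\dots,Y-1\}$, identified with its $X\times X$ matrix $\bm{G}$. For $\delta\ge 0$, the pair $(\bm{A},\bm{G})$ is $\delta$-feasible if there exist encoders $f_1,f_2\colon\mathcal{U}\to\mathcal{X}$ and a decoder $\phi\colon\mathcal{Y}\to\mathcal{W}$ such that, for independent $\mathsf{u}_1,\mathsf{u}_2$ uniformly distributed on $\mathcal{U}$, $$\mathbb{P}\bigl(a(\mathsf{u}_1,\mathsf{u}_2)\ne\phi(g(f_1(\mathsf{u}_1),f_2(\mathsf{u}_2)))\bigr)\le\delta .$$ In particular, $0$-feasible means $\phi(g(f_1(u_1),f_2(u_2)))=a(u_1,u_2)$ for all $u_1,u_2\in\mathcal{U}$. *)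

theory Defs
  imports "HOL-Probability.Probability"
begin

(* PiE makes channels undefined outside their domain, so that each function from
   {0..<X} x {0..<X} to {0..<Y} is counted exactly once. *)
definition channels :: "nat \<Rightarrow> nat \<Rightarrow> (nat \<times> nat \<Rightarrow> nat) set" where
  "channels X Y = ({0..<X} \<times> {0..<X}) \<rightarrow>\<^sub>E {0..<Y}"

(* The target a maps {0..<U} x {0..<U} to W and the channel g maps {0..<X} x {0..<X} to {0..<Y};
   U should be positive. The users' inputs are independent and uniform (pair_pmf is the
   product distribution). *)
definition feasible ::
  "real \<Rightarrow> nat \<Rightarrow> 'w set \<Rightarrow> (nat \<times> nat \<Rightarrow> 'w) \<Rightarrow> nat \<Rightarrow> nat \<Rightarrow> (nat \<times> nat \<Rightarrow> nat) \<Rightarrow> bool" where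
  "feasible \<delta> U W a X Y g \<longleftrightarrow>
     (\<exists>f1 \<in> {0..<U} \<rightarrow> {0..<X}. \<exists>f2 \<in> {0..<U} \<rightarrow> {0..<X}. \<exists>\<phi> \<in> {0..<Y} \<rightarrow> W.
        measure_pmf.prob (pair_pmf (pmf_of_set {0..<U}) (pmf_of_set {0..<U}))
          {(u1, u2). a (u1, u2) \<noteq> \<phi> (g (f1 u1, f2 u2))} \<le> \<delta>)"

definition identity_target :: "nat \<times> nat \<Rightarrow> nat \<times> nat" where
  "identity_target = (\<lambda>(u1, u2). (u1, u2))"

end

(* Deletion argument: restrict the channel to 2U rows and U columns. The expected number of
   ordered pairs of positions with the same output is at most 4 U^4 / Y, so by Markov's inequality
   at most U such pairs occur except with probability 4 U^3 / Y, which tends to 0. Deleting one row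
   for every such pair leaves at least U rows, on which the channel is injective. *)
theory Submission
  imports Defs "HOL-Real_Asymp.Real_Asymp"
begin

text \<open>Pairs are ordered, so every clash is recorded in both orders and the first components
  alone reach all positions involved in one.\<close>

definition collisions :: "'a set \<Rightarrow> ('a \<Rightarrow> 'b) \<Rightarrow> ('a \<times> 'a) set" where
  "collisions R g = {(p, q) \<in> R \<times> R. p \<noteq> q \<and> g p = g q}"

lemma finite_collisions [simp]: "finite R \<Longrightarrow> finite (collisions R g)"
  unfolding collisions_def by (rule finite_subset[of _ "R \<times> R"]) auto

(* Overwriting the value at p is injective on the functions that agree at p and q,
   because the old value can be read off at q. *)
lemma card_PiE_agree_le:
  assumes "finite S" "finite T" "p \<in> S" "q \<in> S" "p \<noteq> q"
  shows "card {g \<in> S \<rightarrow>\<^sub>E T. g p = g q} * card T \<le> card (S \<rightarrow>\<^sub>E T)"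
proof -
  let ?A = "{g \<in> S \<rightarrow>\<^sub>E T. g p = g q}"
  let ?F = "\<lambda>(g, t). g(p := t)"
  have "inj_on ?F (?A \<times> T)"
  proof (rule inj_on_inverseI[where g = "\<lambda>h. (h(p := h q), h p)"])
    fix z assume "z \<in> ?A \<times> T"
    then show "(\<lambda>h. (h(p := h q), h p)) (?F z) = z"
      using assms(5) by (auto simp: fun_eq_iff)
  qed
  moreover have "?F ` (?A \<times> T) \<subseteq> S \<rightarrow>\<^sub>E T"
    using assms(3) by (auto simp: PiE_iff extensional_def)
  moreover have "finite (S \<rightarrow>\<^sub>E T)"
    using assms by (simp add: finite_PiE)
  ultimately have "card (?A \<times> T) \<le> card (S \<rightarrow>\<^sub>E T)"
    by (intro card_inj_on_le)
  then show ?thesis by (simp add: card_cartesian_product)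
qed

text \<open>First moment bound in counting form: exchanging the sums over functions and over pairs,
  each of the at most \<open>card R ^ 2\<close> pairs contributes at most a
  \<open>1 / card T\<close> share of all functions. Multiplying by \<open>card T\<close> keeps
  everything in the natural numbers.\<close>

lemma sum_card_collisions_le:
  assumes "finite S" "finite T" "R \<subseteq> S"
  shows "(\<Sum>g\<in>S \<rightarrow>\<^sub>E T. card (collisions R g)) * card T \<le> card R ^ 2 * card (S \<rightarrow>\<^sub>E T)"
proof -
  let ?G = "S \<rightarrow>\<^sub>E T"
  let ?P = "{(p, q) \<in> R \<times> R. p \<noteq> q}"
  have fR: "finite R" using assms finite_subset by blast
  have fG: "finite ?G" using assms by (simp add: finite_PiE)
  have fP: "finite ?P" by (rule finite_subset[of _ "R \<times> R"]) (use fR in auto)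
  have "(\<Sum>g\<in>?G. card (collisions R g)) = (\<Sum>g\<in>?G. card {z \<in> ?P. g (fst z) = g (snd z)})"
    by (intro sum.cong refl arg_cong[where f = card]) (auto simp: collisions_def)
  also have "\<dots> = (\<Sum>z\<in>?P. card {g \<in> ?G. g (fst z) = g (snd z)})"
    using fG fP by (rule sum_multicount_gen) simp
  finally have "(\<Sum>g\<in>?G. card (collisions R g)) * card T
      = (\<Sum>z\<in>?P. card {g \<in> ?G. g (fst z) = g (snd z)} * card T)"
    by (simp add: sum_distrib_right)
  also have "\<dots> \<le> (\<Sum>z\<in>?P. card ?G)"
    using assms by (intro sum_mono card_PiE_agree_le) auto
  also have "\<dots> \<le> card (R \<times> R) * card ?G"
  proof -
    have "card ?P \<le> card (R \<times> R)" by (rule card_mono) (use fR in auto)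
    then show ?thesis by simp
  qed
  finally show ?thesis by (simp add: card_cartesian_product power2_eq_square)
qed

lemma feasible_identity_if_inj:
  assumes "U > 0" "f1 \<in> {0..<U} \<rightarrow> {0..<X}" "f2 \<in> {0..<U} \<rightarrow> {0..<X}"
    and inj: "inj_on (\<lambda>(u1, u2). g (f1 u1, f2 u2)) ({0..<U} \<times> {0..<U})"
  shows "feasible 0 U ({0..<U} \<times> {0..<U}) identity_target X Y g"
proof -
  let ?D = "{0..<U} \<times> {0..<U}"
  let ?h = "\<lambda>(u1, u2). g (f1 u1, f2 u2)"
  \<comment> \<open>Outputs that no message pair produces are decoded as \<open>(0, 0)\<close>,
    which lies in \<open>?D\<close> because \<open>U > 0\<close>; this makes \<open>\<phi>\<close> a
    legal decoder on all of \<open>{0..<Y}\<close>.\<close>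
  define \<phi> where "\<phi> y = (if y \<in> ?h ` ?D then inv_into ?D ?h y else (0, 0))" for y
  have \<phi>: "\<phi> \<in> {0..<Y} \<rightarrow> ?D"
  proof
    fix y
    show "\<phi> y \<in> ?D"
      using inv_into_into[of y ?h ?D] assms(1) unfolding \<phi>_def by (cases "y \<in> ?h ` ?D") auto
  qed
  have dec: "\<phi> (g (f1 u, f2 v)) = (u, v)" if "(u, v) \<in> ?D" for u v
    using inv_into_f_f[OF inj that] that by (force simp: \<phi>_def)
  have "measure_pmf.prob (pair_pmf (pmf_of_set {0..<U}) (pmf_of_set {0..<U}))
          {(u1, u2). identity_target (u1, u2) \<noteq> \<phi> (g (f1 u1, f2 u2))} = 0"
  proof -
    \<comment> \<open>The error event may contain pairs outside \<open>?D\<close>, so it is only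
      shown to miss the support of the distribution.\<close>
    have "set_pmf (pair_pmf (pmf_of_set {0..<U}) (pmf_of_set {0..<U})) = ?D"
      using assms(1) by (simp add: set_pmf_of_set)
    moreover have "?D \<inter> {(u1, u2). identity_target (u1, u2) \<noteq> \<phi> (g (f1 u1, f2 u2))} = {}"
      using dec by (fastforce simp: identity_target_def)
    ultimately show ?thesis by (simp only: measure_pmf_zero_iff)
  qed
  then have "measure_pmf.prob (pair_pmf (pmf_of_set {0..<U}) (pmf_of_set {0..<U}))
          {(u1, u2). identity_target (u1, u2) \<noteq> \<phi> (g (f1 u1, f2 u2))} \<le> 0"
    by (rule eq_refl)
  then show ?thesis
    unfolding feasible_def using assms(2,3) \<phi> by blast
qed

lemma feasible_identity_if_few_collisions:
  assumes "U > 0" "2 * U \<le> X"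
    and few: "card (collisions ({0..<2 * U} \<times> {0..<U}) g) \<le> U"
  shows "feasible 0 U ({0..<U} \<times> {0..<U}) identity_target X Y g"
proof -
  let ?R = "{0..<2 * U} \<times> {0..<U}"
  \<comment> \<open>The rows to delete: for each collision, the row of its first position.\<close>
  define B where "B = (\<lambda>z. fst (fst z)) ` collisions ?R g"
  have "card B \<le> U"
    unfolding B_def by (rule order_trans[OF card_image_le few]) simp
  moreover have "finite B" unfolding B_def by simp
  ultimately have "U \<le> card ({0..<2 * U} - B)"
    using diff_card_le_card_Diff[of B "{0..<2 * U}"] by simp
  then obtain C where C: "C \<subseteq> {0..<2 * U} - B" "card C = U" "finite C"
    by (rule obtain_subset_with_card_n)
  then obtain f where f: "bij_betw f {0..<U} C"
    using ex_bij_betw_nat_finite by blast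
  have fC: "f u \<in> C" if "u < U" for u
    using f that by (auto simp: bij_betw_def)
  show ?thesis
  proof (rule feasible_identity_if_inj[where ?f2.0 = id])
    show "f \<in> {0..<U} \<rightarrow> {0..<X}" using fC C assms(2) by fastforce
    show "id \<in> {0..<U} \<rightarrow> {0..<X}" using assms(2) by auto
    have "(u, v) = (u', v')"
      if uv: "u < U" "v < U" "u' < U" "v' < U" and eq: "g (f u, v) = g (f u', v')" for u v u' v'
    proof (rule ccontr)
      assume ne: "(u, v) \<noteq> (u', v')"
      \<comment> \<open>Injectivity of \<open>f\<close> keeps the two positions distinct, as a
        collision requires; its first row \<open>f u\<close> then lies in \<open>B\<close>, which
        \<open>C\<close> avoids.\<close>
      have "(f u, v) \<noteq> (f u', v')"
        using ne uv f by (auto simp: bij_betw_def inj_on_def)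
      then have "((f u, v), (f u', v')) \<in> collisions ?R g"
        using uv eq fC[of u] fC[of u'] C(1) by (auto simp: collisions_def)
      then have "f u \<in> B" unfolding B_def by force
      then show False using fC[OF uv(1)] C(1) by auto
    qed
    then show "inj_on (\<lambda>(u1, u2). g (f u1, id u2)) ({0..<U} \<times> {0..<U})"
      unfolding inj_on_def by auto
  qed (use assms in auto)
qed

text \<open>Markov's inequality in counting form: an infeasible channel has more than
  \<open>U\<close> collisions on \<open>?R\<close>, so the total number of collisions over all
  channels bounds \<open>U\<close> times the number of infeasible ones.\<close>

lemma card_infeasible_le:
  assumes "U > 0" "2 * U \<le> X"
  shows "card {g \<in> channels X Y. \<not> feasible 0 U ({0..<U} \<times> {0..<U}) identity_target X Y g} * Y
           \<le> 4 * U ^ 3 * card (channels X Y)"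
proof -
  let ?R = "{0..<2 * U} \<times> {0..<U}"
  let ?N = "{g \<in> channels X Y. \<not> feasible 0 U ({0..<U} \<times> {0..<U}) identity_target X Y g}"
  have fin: "finite (channels X Y)" unfolding channels_def by (simp add: finite_PiE)
  have "card ?N * U = (\<Sum>g\<in>?N. U)" by simp
  also have "\<dots> \<le> (\<Sum>g\<in>?N. card (collisions ?R g))"
  proof (rule sum_mono)
    fix g assume "g \<in> ?N"
    then have "\<not> card (collisions ?R g) \<le> U"
      using feasible_identity_if_few_collisions[OF assms] by blast
    then show "U \<le> card (collisions ?R g)" by simp
  qed
  also have "\<dots> \<le> (\<Sum>g\<in>channels X Y. card (collisions ?R g))"
    by (rule sum_mono2[OF fin]) auto
  finally have "card ?N * U * Y \<le> (\<Sum>g\<in>channels X Y. card (collisions ?R g)) * Y"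
    by (rule mult_right_mono) simp
  also have "\<dots> \<le> card ?R ^ 2 * card (channels X Y)"
    using sum_card_collisions_le[of "{0..<X} \<times> {0..<X}" "{0..<Y}" ?R] assms(2)
    unfolding channels_def by fastforce
  \<comment> \<open>\<open>?R\<close> has 2 U^2 positions, whose square is 4 U^4; one factor
    \<open>U\<close> is set aside for cancelling.\<close>
  also have "\<dots> = U * (4 * U ^ 3 * card (channels X Y))"
    by (simp add: card_cartesian_product power2_eq_square power3_eq_cube)
  finally have "U * (card ?N * Y) \<le> U * (4 * U ^ 3 * card (channels X Y))"
    by (simp add: mult_ac)
  then show ?thesis using assms(1) by simp
qed

lemma card_feasible_ratio_ge:
  assumes "U > 0" "2 * U \<le> X" "Y > 0"
  shows "1 - 4 * real U ^ 3 / real Y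
    \<le> real (card {g \<in> channels X Y. feasible 0 U ({0..<U} \<times> {0..<U}) identity_target X Y g})
        / real (card (channels X Y))"
proof -
  let ?F = "{g \<in> channels X Y. feasible 0 U ({0..<U} \<times> {0..<U}) identity_target X Y g}"
  let ?N = "{g \<in> channels X Y. \<not> feasible 0 U ({0..<U} \<times> {0..<U}) identity_target X Y g}"
  let ?c = "real (card (channels X Y))"
  have fin: "finite (channels X Y)" unfolding channels_def by (simp add: finite_PiE)
  \<comment> \<open>\<open>Y > 0\<close> guarantees that some channel exists, so dividing by
    \<open>?c\<close> is meaningful.\<close>
  have pos: "?c > 0"
    using assms(3) by (simp add: channels_def card_PiE)
  have "card (channels X Y) = card (?F \<union> ?N)" by (rule arg_cong[where f = card]) auto
  also have "\<dots> = card ?F + card ?N" by (rule card_Un_disjoint) (use fin in auto)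
  finally have F: "real (card ?F) = ?c - real (card ?N)" by simp
  have "real (card ?N * Y) \<le> real (4 * U ^ 3 * card (channels X Y))"
    using card_infeasible_le[OF assms(1,2)] of_nat_mono by blast
  then have "real (card ?N) / ?c \<le> 4 * real U ^ 3 / real Y"
    using pos assms(3) by (simp add: field_simps)
  then show ?thesis unfolding F using pos by (simp add: diff_divide_distrib)
qed

text \<open>A real \<open>c\<close> strictly between \<open>a\<close> and the liminf turns the bound
  on logarithms into polynomial growth with exponent to spare. The guard \<open>X U > 0\<close> is
  there because exponentiating \<open>ln (real (X U))\<close> returns \<open>X U\<close> only for a
  positive argument.\<close>

lemma eventually_powr_less_of_liminf:
  fixes X :: "nat \<Rightarrow> nat"
  assumes "liminf (\<lambda>U. ereal (ln (real (X U)) / ln (real U))) > ereal a"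
  obtains c where "c > a" "eventually (\<lambda>U. X U > 0 \<longrightarrow> real U powr c < real (X U)) sequentially"
proof -
  obtain c where c: "a < c" "ereal c < liminf (\<lambda>U. ereal (ln (real (X U)) / ln (real U)))"
    using ereal_dense2[OF assms] by auto
  have "eventually (\<lambda>U. X U > 0 \<longrightarrow> real U powr c < real (X U)) sequentially"
    using less_LiminfD[OF c(2)] eventually_ge_at_top[of 2]
  proof eventually_elim
    case (elim U)
    then have "c * ln (real U) < ln (real (X U))"
      by (simp add: pos_less_divide_eq)
    then show ?case
      using elim by (auto simp: powr_def intro: exp_less_mono[THEN less_le_trans])
  qed
  with c(1) show ?thesis by (rule that)
qed

theorem theorem1:
  fixes X Y :: "nat \<Rightarrow> nat"
  assumes "\<And>U. U \<ge> 2 \<Longrightarrow> X U \<ge> 2"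
    and "\<And>U. U \<ge> 2 \<Longrightarrow> Y U \<ge> 2"
    and "liminf (\<lambda>U. ereal (ln (real (X U)) / ln (real U))) > 1"
    and "liminf (\<lambda>U. ereal (ln (real (Y U)) / ln (real U))) > 3"
  shows "(\<lambda>U. real (card {g \<in> channels (X U) (Y U).
                 feasible 0 U ({0..<U} \<times> {0..<U}) identity_target (X U) (Y U) g})
            / real (card (channels (X U) (Y U)))) \<longlonglongrightarrow> 1"
    (is "?r \<longlonglongrightarrow> 1")
proof -
  obtain c where c: "c > 1" "eventually (\<lambda>U. X U > 0 \<longrightarrow> real U powr c < real (X U)) sequentially"
    using eventually_powr_less_of_liminf[of 1 X] assms(3) by (auto simp: one_ereal_def)
  obtain d where d: "d > 3" "eventually (\<lambda>U. Y U > 0 \<longrightarrow> real U powr d < real (Y U)) sequentially"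
    using eventually_powr_less_of_liminf[of 3 Y] assms(4) by auto
  \<comment> \<open>The surplus \<open>c > 1\<close> absorbs the factor 2 of the doubled number of
    rows.\<close>
  have "eventually (\<lambda>U. 2 * real U \<le> real U powr c) sequentially"
    using c(1) by real_asymp
  with c(2) d(2) eventually_ge_at_top[of 2]
  have lower: "eventually (\<lambda>U. 1 - 4 * real U powr (3 - d) \<le> ?r U) sequentially"
  proof eventually_elim
    case (elim U)
    have X: "2 * U \<le> X U" and Y: "Y U > 0" "real U powr d < real (Y U)"
      using elim assms(1,2)[of U] by fastforce+
    \<comment> \<open>Splitting off \<open>real U powr d\<close>, which is below \<open>Y U\<close>,
      leaves the error term with the negative exponent \<open>3 - d\<close>.\<close>
    have "real U ^ 3 = real U powr (3 - d) * real U powr d"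
      using elim by (simp flip: powr_add powr_numeral)
    also have "\<dots> \<le> real U powr (3 - d) * real (Y U)"
      using Y by (intro mult_left_mono) auto
    finally have "4 * real U ^ 3 / real (Y U) \<le> 4 * real U powr (3 - d)"
      using Y by (simp add: field_simps)
    then show ?case
      using card_feasible_ratio_ge[of U "X U" "Y U"] X Y elim by linarith
  qed
  \<comment> \<open>This covers \<open>U < 2\<close> as well, where there may be no channels and the
    quotient is then 0.\<close>
  have upper: "?r U \<le> 1" for U
  proof -
    have "finite (channels (X U) (Y U))" unfolding channels_def by (simp add: finite_PiE)
    then have "card {g \<in> channels (X U) (Y U).
        feasible 0 U ({0..<U} \<times> {0..<U}) identity_target (X U) (Y U) g} \<le> card (channels (X U) (Y U))"
      by (intro card_mono) auto
    then show ?thesis by (auto simp: divide_le_eq_1)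
  qed
  show ?thesis
  proof (rule tendsto_sandwich[OF lower])
    show "(\<lambda>U. 1 - 4 * real U powr (3 - d)) \<longlonglongrightarrow> 1"
      using d(1) by real_asymp
  qed (use upper in auto)
qed

end
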